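(* Fix a positive integer $k$. Let $T$ be the threshold choosing function $T(k,A,h)=m_{k+1}$, where $m_{k+1}$ is the $(k+1)$-st smallest distinct hash value among the hash values of the identifiers of the stream $A$. Then $T$ satisfies $1$-Goodness: for every stream $A$ on which $T$ is defined (i.e. with at least $k+1$ distinct identifiers), every distinct identifier $\ell$ of $A$, and every fixed assignment $X^{n_A}_{-\ell}$ of hash values to the distinct identifiers of $A$ other than $\ell$, the fix-all-but-one projection $x_\ell\mapsto T_\ell[X^{n_A}_{-\ell}](x_\ell)$ satisfies $1$-Goodness for univariate functions.
   Context: Identifiers come from a universe $[n]=\{1,\dots,n\}$. A stream $A$ is a finite sequence of identifiers (repetitions allowed), and $n_A$ is its number of distinct identifiers. A hash function $h:[n]\to(0,1)$ assigns hash values; $X^{n_A}$ denotes the assignment of hash values to the $n_A$ distinct identifiers of $A$. A threshold choosing function (TCF) maps a target size $k$, a stream $A$ and $h$ to a threshold in $(0,1]$, depending on $h$ only through $X^{n_A}$; for fixed $k$ and $A$ we write $T(X^{n_A})$. Fix-all-but-one projection: for a distinct identifier $\ell$ of $A$ and a fixed assignment $X^{n_A}_{-\ell}$ of hash values to all distinct identifiers of $A$ except $\ell$, $T_\ell[X^{n_A}_{-\ell}](x_\ell):=T(X^{n_A})$, where $X^{n_A}$ combines $X^{n_A}_{-\ell}$ with the value $x_\ell$ for $\ell$; it is a function $(0,1)\to(0,1]$. A function $f:(0,1)\to(0,1]$ satisfies $1$-Goodness if there exists a threshold $F$ such that $x<F$ implies $f(x)=F$, and $x\ge F$ implies $f(x)\le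 x$.
   Formalization: Each distinct identifier contributes one hash value, so equal hash values of different identifiers are counted separately; with only distinct values counted, the claim fails when x equals another value (k=1, other values a<b: f(x)=a for x<a but f(a)=b>a). *)

theory Defs
  imports Complex_Main "HOL-Library.FuncSet"
begin

definition streams :: "nat \<Rightarrow> nat list set" where
  "streams n = lists {1..n}"

definition one_good :: "(real \<Rightarrow> real) \<Rightarrow> bool" where
  "one_good f \<longleftrightarrow> f \<in> {0<..<1} \<rightarrow> {0<..1} \<and>
     (\<exists>F\<in>{0<..1}. \<forall>x\<in>{0<..<1}. (x < F \<longrightarrow> f x = F) \<and> (F \<le> x \<longrightarrow> f x \<le> x))"

text \<open>
  For a fixed target size, a threshold choosing function is represented as a function
  of a stream and a hash function. Only the hash values of identifiers occurring in the stream
  may matter, so it can equally be applied to an assignment of hash values to these identifiers,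
  i.e. an element of \<open>set A \<rightarrow>\<^sub>E {0<..<1}\<close>.
\<close>

type_synonym tcf = "nat list \<Rightarrow> (nat \<Rightarrow> real) \<Rightarrow> real"

definition fix_all_but_one :: "tcf \<Rightarrow> nat list \<Rightarrow> nat \<Rightarrow> (nat \<Rightarrow> real) \<Rightarrow> real \<Rightarrow> real" where
  "fix_all_but_one T A l X = (\<lambda>x. T A (X(l := x)))"

text \<open>A threshold choosing function may be partial; \<open>D\<close> is the set of streams on which
  it is defined.\<close>

definition tcf_one_good :: "nat \<Rightarrow> nat list set \<Rightarrow> tcf \<Rightarrow> bool" where
  "tcf_one_good n D T \<longleftrightarrow>
     (\<forall>A \<in> streams n \<inter> D. \<forall>l \<in> set A. \<forall>X \<in> (set A - {l}) \<rightarrow>\<^sub>E {0<..<1}.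
        one_good (fix_all_but_one T A l X))"

text \<open>
  The \<open>(k+1)\<close>-st smallest hash value (list positions start at 0), where every distinct
  identifier of the stream contributes one value, however often it is repeated. For a
  collision-free hash function this is the \<open>(k+1)\<close>-st element of the set of hash values, see
  \<open>m_succ_eq_set\<close> below. If two distinct identifiers collide, both count: removing equal values
  would leave the threshold undefined on some streams with \<open>k+1\<close> distinct identifiers, and
  1-Goodness would fail (for \<open>k = 1\<close> and other hash values \<open>a < b\<close>, the threshold would be \<open>a\<close>
  for \<open>x < a\<close> but \<open>b\<close> at \<open>x = a\<close>).
\<close>

definition m_succ :: "nat \<Rightarrow> tcf" where
  "m_succ k A h = sort (map h (remdups A)) ! k"

lemma m_succ_restrict: "m_succ k A (restrict h (set A)) = m_succ k A h"
proof -
  have "map (restrict h (set A)) (remdups A) = map h (remdups A)" by simp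
  then show ?thesis by (simp only: m_succ_def)
qed

lemma m_succ_eq_set:
  assumes "inj_on h (set A)"
  shows "m_succ k A h = sorted_list_of_set (h ` set A) ! k"
proof -
  have "distinct (map h (remdups A))"
    using assms by (simp add: distinct_map)
  then have "sorted_list_of_set (set (map h (remdups A))) = sort (map h (remdups A))"
    by (simp only: sorted_list_of_set_sort_remdups distinct_remdups_id)
  then show ?thesis by (simp add: m_succ_def)
qed

end

(* Let F be the k-th smallest of the hash values of the identifiers other than l. Inserting x into
   the sorted list of these values shifts F to position k + 1 if x < F; otherwise x itself and
   the k values up to F are all at most x, so the (k+1)-st smallest value is at most x. *)

theory Submission
  imports Defs "HOL-Library.Multiset"
begin

text \<open>\<open>insort\<close> puts \<open>x\<close> in front of the first entry that is at least
  \<open>x\<close>. Here that happens at position \<open>i\<close> or earlier, so entry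
  \<open>i\<close> moves one place on.\<close>

lemma insort_nth_Suc_if_less:
  assumes "i < length ys" "x < ys ! i"
  shows "insort x ys ! Suc i = ys ! i"
  using assms
proof (induction ys arbitrary: i)
  case (Cons a ys)
  then show ?case by (cases i) auto
qed simp

text \<open>Position \<open>Suc i\<close> holds \<open>ys ! i\<close>, \<open>x\<close> itself, or
  an entry below \<open>x\<close> that \<open>x\<close> has passed.\<close>

lemma insort_nth_Suc_le_if_le:
  assumes "i < length ys" "ys ! i \<le> x"
  shows "insort x ys ! Suc i \<le> x"
  using assms
proof (induction ys arbitrary: i)
  case (Cons a ys)
  \<comment> \<open>For \<open>i = 0\<close> and \<open>a < x\<close>, position 1 of the result is
    the head of the insertion into the tail.\<close>
  have "insort x ys ! 0 \<le> x" by (cases ys) auto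
  with Cons show ?case by (cases i) auto
qed simp

text \<open>Isolates the dependence on \<open>x\<close>: \<open>l\<close> occurs exactly once, so
  the update changes a single list entry, and sorting depends only on the multiset of
  values.\<close>

lemma sort_map_fun_upd:
  assumes "distinct xs" "l \<in> set xs"
  shows "sort (map (f(l := x)) xs) = insort x (sort (map f (remove1 l xs)))"
proof -
  have "mset xs = add_mset l (mset (remove1 l xs))"
    using assms(2) by simp
  then have "mset (map (f(l := x)) xs) = mset (x # map (f(l := x)) (remove1 l xs))"
    by (simp del: mset_remove1)
  also have "map (f(l := x)) (remove1 l xs) = map f (remove1 l xs)"
    using assms(1) by simp
  finally have "sort (map (f(l := x)) xs) = sort (x # map f (remove1 l xs))"
    by (metis properties_for_sort mset_sort sorted_sort)
  then show ?thesis by simp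
qed

theorem theorem6:
  fixes n k :: nat
  assumes "0 < k"
  shows "tcf_one_good n {A. k + 1 \<le> card (set A)} (m_succ k)"
  unfolding tcf_one_good_def
proof (intro ballI)
  fix A l X
  assume A: "A \<in> streams n \<inter> {A. k + 1 \<le> card (set A)}" and l: "l \<in> set A"
    and X: "X \<in> (set A - {l}) \<rightarrow>\<^sub>E {0<..<1::real}"
  define ys where "ys = sort (map X (remove1 l (remdups A)))"
  define F where "F = ys ! (k - 1)"
  have f: "fix_all_but_one (m_succ k) A l X x = insort x ys ! k" for x
    using l by (simp add: fix_all_but_one_def m_succ_def ys_def sort_map_fun_upd)
  \<comment> \<open>Of at least \<open>k + 1\<close> distinct identifiers, only \<open>l\<close> is
    dropped.\<close>
  have len: "k \<le> length ys"
    using A l by (auto simp: ys_def length_remove1 length_remdups_card_conv)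
  have ys: "set ys \<subseteq> {0<..<1}"
    using X by (auto simp: ys_def PiE_iff)
  have "F \<in> set ys"
    unfolding F_def using len \<open>0 < k\<close> by (intro nth_mem) simp
  with ys have F: "F \<in> {0<..<1}" by blast
  have range: "insort x ys ! k \<in> {0<..1}" if "x \<in> {0<..<1}" for x
  proof -
    have "insort x ys ! k \<in> set (insort x ys)"
      using len by (intro nth_mem) simp
    then have "insort x ys ! k \<in> {0<..<1}"
      using that ys by (auto simp: set_insort_key)
    then show ?thesis by simp
  qed
  show "one_good (fix_all_but_one (m_succ k) A l X)"
    unfolding one_good_def
  proof (intro conjI bexI[of _ F] ballI impI)
    show "fix_all_but_one (m_succ k) A l X \<in> {0<..<1} \<rightarrow> {0<..1}"
      using range by (simp add: f)
    show "F \<in> {0<..1}" using F by simp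
    show "fix_all_but_one (m_succ k) A l X x = F" if "x < F" for x
      \<comment> \<open>As \<open>0 < k\<close>, position \<open>Suc (k - 1)\<close> is
        \<open>k\<close>, where \<open>m_succ\<close> reads its value.\<close>
      using insort_nth_Suc_if_less[of "k - 1" ys x] that len \<open>0 < k\<close> by (simp add: f F_def)
    show "fix_all_but_one (m_succ k) A l X x \<le> x" if "F \<le> x" for x
      using insort_nth_Suc_le_if_le[of "k - 1" ys x] that len \<open>0 < k\<close> by (simp add: f F_def)
  qed
qed

end
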